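(* Let $P$ be a finite graded poset. Then $P$ is an Eeta win if and only if, for every maximal element $m$ of $P$, $\mathcal{T}_P(m)$ evaluates to $1$ when considered as a boolean $\mathrm{NAND}$ formula on inputs of all $0$.
   Context: Ungar game: for a finite poset $P$, the positions are order ideals (down-closed subsets) $X$ of $P$, the starting position being $X=P$. A nontrivial Ungar move replaces $X$ by $X\setminus T$, where $T$ is a nonempty subset of the set $\max(X)$ of maximal elements of $X$. Two players, Atniss (who moves first) and Eeta (who moves second), alternate making nontrivial Ungar moves; the first player who cannot make one (i.e. the player to move when $X=\varnothing$) loses. A finite poset $P$ is an Atniss win if the first player has a winning strategy starting from $P$, and an Eeta win otherwise. Any subset of a poset is regarded as a poset with the induced order. A poset $P$ is graded if there is a rank function $\rho:P\to\mathbb{N}$ with $\rho(x)=\rho(y)+1$ whenever $x$ covers $y$ (maximal elements need not have equal rank, nor minimal elements). For a maximal element $m$ of $P$, the maximal subposet $\mathcal{M}_P(m)$ is the subposet of all elements that are less than or equal to $m$ but not less than or equal to any other maximal element of $P$. The skeleton $\mathcal{T}_P$ is the subposet of all $x\in P$ for which there are no incomparable $a,b\in P$ with $x<a$ and $x<b$. The component of the skeleton at $m$ is $\mathcal{T}_P(m)=\mathcal{T}_P\cap\mathcal{M}_P(m)$; it is a rooted tree poset, i.e. it has a single maximal element ($m$) and its Hasse diagram is graph-theoretically a tree. $\mathrm{NAND}:\{0,1\}^*\to\{0,1\}$ returns $0$ if and only if every letter of the input string is $1$. A finite rooted tree poset $Q$ is considered as a boolean NAND formula by directing each edge of its Hasse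 diagram from the covered element to the covering element. On inputs of all $0$, every minimal element of $Q$ is assigned the value $0$, and every non-minimal element is assigned the NAND of the values of the elements it covers in $Q$. The formula evaluates to the value of the maximal element of $Q$. (If $Q$ has one element, it evaluates to $0$.) *)

theory Defs
  imports Main
begin

text \<open>
  A poset is a set of elements of an ordered type, carrying the induced order.
\<close>

definition maximals :: "'a::order set \<Rightarrow> 'a set" where
  "maximals X = {x \<in> X. \<forall>y\<in>X. \<not> x < y}"

definition minimals :: "'a::order set \<Rightarrow> 'a set" where
  "minimals X = {x \<in> X. \<forall>y\<in>X. \<not> y < x}"

text \<open>\<open>covers P x y\<close>: the element \<open>x\<close> covers \<open>y\<close> in the poset \<open>P\<close>.\<close>

definition covers :: "'a::order set \<Rightarrow> 'a \<Rightarrow> 'a \<Rightarrow> bool" where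
  "covers P x y \<longleftrightarrow> x \<in> P \<and> y \<in> P \<and> y < x \<and> \<not> (\<exists>z\<in>P. y < z \<and> z < x)"

definition graded :: "'a::order set \<Rightarrow> bool" where
  "graded P \<longleftrightarrow> (\<exists>\<rho>::'a \<Rightarrow> nat. \<forall>x y. covers P x y \<longrightarrow> \<rho> x = \<rho> y + 1)"

text \<open>
  Nontrivial Ungar moves. Starting from \<open>P\<close>, only order ideals of \<open>P\<close> can be
  reached, so that positions need not be restricted explicitly.
\<close>

definition ungar_move :: "'a::order set \<Rightarrow> 'a set \<Rightarrow> bool" where
  "ungar_move X Y \<longleftrightarrow> (\<exists>T. T \<noteq> {} \<and> T \<subseteq> maximals X \<and> Y = X - T)"

text \<open>
  A (possibly unfinished) play is the nonempty list of the positions visited so far,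
  beginning with \<open>P\<close>. Atniss is to move exactly when the list has odd length.
\<close>

definition ungar_play :: "'a::order set \<Rightarrow> 'a set list \<Rightarrow> bool" where
  "ungar_play P Xs \<longleftrightarrow> Xs \<noteq> [] \<and> hd Xs = P \<and> successively ungar_move Xs"

text \<open>
  A strategy for Atniss maps the history of a play to the next position;
  \<open>atniss_follows \<sigma> Xs\<close> says that all her moves in \<open>Xs\<close> are the ones chosen by \<open>\<sigma>\<close>.
\<close>

definition atniss_follows :: "('a set list \<Rightarrow> 'a set) \<Rightarrow> 'a set list \<Rightarrow> bool" where
  "atniss_follows \<sigma> Xs \<longleftrightarrow>
    (\<forall>i. even i \<and> Suc i < length Xs \<longrightarrow> Xs ! Suc i = \<sigma> (take (Suc i) Xs))"

text \<open>
  A winning strategy proposes a legal move whenever it is Atniss' turn and a move exists,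
  and every finished play following it is lost by Eeta, i.e. Eeta is the player who
  is to move at its end.
\<close>

definition atniss_winning_strategy ::
    "'a::order set \<Rightarrow> ('a set list \<Rightarrow> 'a set) \<Rightarrow> bool" where
  "atniss_winning_strategy P \<sigma> \<longleftrightarrow>
    (\<forall>Xs. ungar_play P Xs \<and> atniss_follows \<sigma> Xs \<longrightarrow>
      (odd (length Xs) \<and> (\<exists>Y. ungar_move (last Xs) Y) \<longrightarrow> ungar_move (last Xs) (\<sigma> Xs)) \<and>
      ((\<nexists>Y. ungar_move (last Xs) Y) \<longrightarrow> even (length Xs)))"

definition atniss_win :: "'a::order set \<Rightarrow> bool" where
  "atniss_win P \<longleftrightarrow> (\<exists>\<sigma>. atniss_winning_strategy P \<sigma>)"

definition eeta_win :: "'a::order set \<Rightarrow> bool" where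
  "eeta_win P \<longleftrightarrow> \<not> atniss_win P"

definition maximal_subposet :: "'a::order set \<Rightarrow> 'a \<Rightarrow> 'a set" where
  "maximal_subposet P m = {x \<in> P. x \<le> m \<and> (\<forall>m'\<in>maximals P. m' \<noteq> m \<longrightarrow> \<not> x \<le> m')}"

definition skeleton :: "'a::order set \<Rightarrow> 'a set" where
  "skeleton P = {x \<in> P. \<not> (\<exists>a\<in>P. \<exists>b\<in>P. \<not> a \<le> b \<and> \<not> b \<le> a \<and> x < a \<and> x < b)}"

definition skeleton_component :: "'a::order set \<Rightarrow> 'a \<Rightarrow> 'a set" where
  "skeleton_component P m = skeleton P \<inter> maximal_subposet P m"

text \<open>
  The bits 0 and 1 are \<open>False\<close> and \<open>True\<close>. The value of NAND on a string only depends on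
  the set of letters occurring in it, so \<open>nand\<close> is defined on sets of bits.
\<close>

definition nand :: "bool set \<Rightarrow> bool" where
  "nand V \<longleftrightarrow> \<not> (\<forall>v\<in>V. v)"

text \<open>
  The value of the element \<open>x\<close> of the finite poset \<open>Q\<close> on inputs of all 0. The test for
  finiteness only serves termination; the value for infinite \<open>Q\<close> is immaterial.
\<close>

function nand_value :: "'a::order set \<Rightarrow> 'a \<Rightarrow> bool" where
  "nand_value Q x =
    (if infinite Q \<or> x \<in> minimals Q then False
     else nand (nand_value Q ` {y. covers Q x y}))"
  by auto
termination
proof (relation "measure (\<lambda>(Q, x). card {y \<in> Q. y < x})", goal_cases)
  case 1
  then show ?case by simp
next
  case (2 Q x y)
  then have "finite Q" and "y \<in> Q" "y < x" by (auto simp: covers_def)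
  then have "{z \<in> Q. z < y} \<subset> {z \<in> Q. z < x}" by auto
  with \<open>finite Q\<close> show ?case by (simp add: psubset_card_mono)
qed

declare nand_value.simps [simp del]

text \<open>
  Value of the formula given by a finite rooted tree poset, namely the value of its
  unique maximal element.
\<close>

definition nand_eval :: "'a::order set \<Rightarrow> bool" where
  "nand_eval Q = nand_value Q (THE r. r \<in> maximals Q)"

end

theory Submission
  imports Defs
begin

text \<open>
  Call a position \<open>X\<close> balanced if every maximal element has value 1 in the skeleton of \<open>X\<close>.
  The balanced positions are exactly the ones lost for the player to move. For this it
  suffices (\<open>eeta_win_iff_kernel\<close>) that no move leads from a balanced position to a balanced
  one (\<open>balanced_no_move_to_balanced\<close>), and that some move leads from every other position
  to a balanced one (\<open>unbalanced_move_to_balanced\<close>).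

  Both facts rest on \<open>skeleton_below_stable\<close>: deleting maximal elements whose ranks exceed
  the rank of a skeleton element \<open>c\<close> leaves the skeleton below \<open>c\<close> unchanged. The
  skeleton can grow at \<open>x < c\<close> only if a deleted element \<open>a\<close> was above \<open>x\<close> and not above
  \<open>c\<close>; descending from \<open>a\<close> to \<open>x\<close>, the first step lands strictly below \<open>c\<close>, so the rank
  of \<open>a\<close> is at most that of \<open>c\<close>.

  If \<open>X\<close> is balanced and \<open>T\<close> is deleted, let \<open>m \<in> T\<close> be of least rank. Having value 1, \<open>m\<close>
  covers a skeleton element \<open>c\<close> of value 0, which becomes maximal and keeps its value since all
  of \<open>T\<close> has larger rank; the new position is not balanced.

  If \<open>X\<close> is not balanced, visit its maximal elements by increasing rank and delete
  each one whose value is 0 at the time of its visit. The elements becoming maximal after the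
  deletion of \<open>m\<close> were covered by \<open>m\<close> alone, hence belonged to the skeleton, and they
  have value 1 because \<open>m\<close> has value 0. Value 1 of an element already visited
  persists: it is witnessed by a covered element of value 0 and of smaller rank than everything
  deleted afterwards. So the result is balanced. All deletions together are a single move, which
  is nontrivial because \<open>X\<close> itself is not balanced.
\<close>


section \<open>Games with a kernel\<close>

lemma ungar_play_snoc:
  assumes "ungar_play P Xs" and "ungar_move (last Xs) Y"
  shows "ungar_play P (Xs @ [Y])"
  using assms by (auto simp: ungar_play_def successively_append_iff)

lemma atniss_follows_snoc_iff:
  assumes "Xs \<noteq> []"
  shows "atniss_follows \<sigma> (Xs @ [Y]) \<longleftrightarrow>
    atniss_follows \<sigma> Xs \<and> (odd (length Xs) \<longrightarrow> Y = \<sigma> Xs)"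
proof
  assume f: "atniss_follows \<sigma> (Xs @ [Y])"
  have "Xs ! Suc i = \<sigma> (take (Suc i) Xs)" if "even i" "Suc i < length Xs" for i
    using f[unfolded atniss_follows_def, rule_format, of i] that by (simp add: nth_append)
  moreover have "Y = \<sigma> Xs" if "odd (length Xs)"
    using f[unfolded atniss_follows_def, rule_format, of "length Xs - 1"] that assms
    by (simp add: nth_append)
  ultimately show "atniss_follows \<sigma> Xs \<and> (odd (length Xs) \<longrightarrow> Y = \<sigma> Xs)"
    by (simp add: atniss_follows_def)
next
  assume f: "atniss_follows \<sigma> Xs \<and> (odd (length Xs) \<longrightarrow> Y = \<sigma> Xs)"
  show "atniss_follows \<sigma> (Xs @ [Y])"
    unfolding atniss_follows_def
  proof (intro allI impI, elim conjE)
    fix i assume i: "even i" "Suc i < length (Xs @ [Y])"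
    show "(Xs @ [Y]) ! Suc i = \<sigma> (take (Suc i) (Xs @ [Y]))"
    proof (cases "Suc i = length Xs")
      case True
      then have "odd (length Xs)" using i(1) by (metis even_Suc)
      with f show ?thesis unfolding True by simp
    next
      case False
      with f i show ?thesis by (auto simp: atniss_follows_def nth_append)
    qed
  qed
qed

lemma maximals_subset: "maximals X \<subseteq> X"
  by (auto simp: maximals_def)

lemma ungar_move_psubset: "ungar_move X Y \<Longrightarrow> Y \<subset> X"
  using maximals_subset[of X] by (auto simp: ungar_move_def)

text \<open>
  If Atniss starts outside the kernel \<open>E\<close>, she wins by always moving into it. If she starts
  inside, Eeta answers every move by returning to \<open>E\<close>, and Atniss runs out of moves because the
  positions shrink. The invariant \<open>G\<close> collects properties of the reachable positions.
\<close>

lemma eeta_win_iff_kernel: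
  fixes P :: "'a::order set"
  assumes fin: "finite P" and G: "G P"
    and G_move: "\<And>X Y. G X \<Longrightarrow> ungar_move X Y \<Longrightarrow> G Y"
    and leave: "\<And>X Y. G X \<Longrightarrow> E X \<Longrightarrow> ungar_move X Y \<Longrightarrow> \<not> E Y"
    and enter: "\<And>X. G X \<Longrightarrow> \<not> E X \<Longrightarrow> \<exists>Y. ungar_move X Y \<and> E Y"
  shows "eeta_win P \<longleftrightarrow> E P"
proof -
  have play_G: "G (last Xs) \<and> finite (last Xs)" if "ungar_play P Xs" for Xs
    using that
  proof (induction Xs rule: rev_induct)
    case Nil
    then show ?case by (simp add: ungar_play_def)
  next
    case (snoc Y Xs)
    show ?case
    proof (cases "Xs = []")
      case True
      with snoc.prems fin G show ?thesis by (auto simp: ungar_play_def)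
    next
      case False
      with snoc.prems have "ungar_play P Xs" "ungar_move (last Xs) Y"
        by (auto simp: ungar_play_def successively_append_iff)
      with snoc.IH G_move ungar_move_psubset show ?thesis
        by (metis finite_subset last_snoc psubset_imp_subset)
    qed
  qed
  have "atniss_win P" if "\<not> E P"
  proof -
    define \<sigma> where "\<sigma> Xs = (SOME Y. ungar_move (last Xs) Y \<and> E Y)" for Xs :: "'a set list"
    have \<sigma>: "ungar_move (last Xs) (\<sigma> Xs) \<and> E (\<sigma> Xs)"
      if "G (last Xs)" "\<not> E (last Xs)" for Xs
      unfolding \<sigma>_def by (rule someI_ex[OF enter[OF that]])
    have inv: "E (last Xs) \<longleftrightarrow> even (length Xs)"
      if "ungar_play P Xs" "atniss_follows \<sigma> Xs" for Xs
      using that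
    proof (induction Xs rule: rev_induct)
      case Nil
      then show ?case by (simp add: ungar_play_def)
    next
      case (snoc Y Xs)
      show ?case
      proof (cases "Xs = []")
        case True
        with snoc.prems \<open>\<not> E P\<close> show ?thesis by (auto simp: ungar_play_def)
      next
        case False
        with snoc.prems have play: "ungar_play P Xs" "ungar_move (last Xs) Y"
          by (auto simp: ungar_play_def successively_append_iff)
        from snoc.prems False have fol: "atniss_follows \<sigma> Xs" "odd (length Xs) \<longrightarrow> Y = \<sigma> Xs"
          by (auto simp: atniss_follows_snoc_iff)
        show ?thesis
          using snoc.IH[OF play(1) fol(1)] fol(2) \<sigma>[of Xs] play_G[OF play(1)] leave play(2)
          by (cases "even (length Xs)") auto
      qed
    qed
    have "atniss_winning_strategy P \<sigma>"
      unfolding atniss_winning_strategy_def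
      using inv \<sigma> enter play_G by blast
    then show ?thesis by (auto simp: atniss_win_def)
  qed
  moreover have False if "E P" and win: "atniss_winning_strategy P \<sigma>" for \<sigma>
  proof -
    have False if "ungar_play P Xs" "atniss_follows \<sigma> Xs" "odd (length Xs)" "E (last Xs)" for Xs
      using that
    proof (induction "card (last Xs)" arbitrary: Xs rule: less_induct)
      case less
      note play = less.prems(1) and G = play_G[OF less.prems(1)]
      have "Xs \<noteq> []" using play by (simp add: ungar_play_def)
      have Y: "ungar_move (last Xs) (\<sigma> Xs)"
        using win less.prems unfolding atniss_winning_strategy_def by blast
      obtain Z where Z: "ungar_move (\<sigma> Xs) Z" "E Z"
        using enter G_move leave Y G less.prems(4) by blast
      let ?Zs = "(Xs @ [\<sigma> Xs]) @ [Z]"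
      have "ungar_play P ?Zs"
        using ungar_play_snoc[OF ungar_play_snoc[OF play Y]] Z(1) by simp
      moreover have "atniss_follows \<sigma> ?Zs"
        using less.prems \<open>Xs \<noteq> []\<close> by (simp add: atniss_follows_snoc_iff del: append_assoc)
      moreover have "card (last ?Zs) < card (last Xs)"
        using ungar_move_psubset[OF Y] ungar_move_psubset[OF Z(1)] G
        by (auto intro!: psubset_card_mono)
      ultimately show False using less.hyps[of ?Zs] less.prems(3) Z(2) by simp
    qed
    from this[of "[P]"] \<open>E P\<close> show False
      by (simp add: ungar_play_def atniss_follows_def)
  qed
  ultimately show ?thesis by (auto simp: eeta_win_def atniss_win_def)
qed


section \<open>Rank functions\<close>

definition rank_function :: "('a::order \<Rightarrow> nat) \<Rightarrow> 'a set \<Rightarrow> bool" where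
  "rank_function \<rho> X \<longleftrightarrow> (\<forall>x y. covers X x y \<longrightarrow> \<rho> x = \<rho> y + 1)"

lemma exists_lower_cover:
  assumes "finite X" and "x \<in> X" "y \<in> X" "y < x"
  obtains z where "covers X x z" "y \<le> z"
proof -
  have "finite {z \<in> X. y \<le> z \<and> z < x}" "{z \<in> X. y \<le> z \<and> z < x} \<noteq> {}"
    using assms by auto
  from finite_has_maximal[OF this] obtain z
    where z: "z \<in> X" "y \<le> z" "z < x"
      and greatest: "\<And>w. w \<in> X \<Longrightarrow> y \<le> w \<Longrightarrow> w < x \<Longrightarrow> z \<le> w \<Longrightarrow> z = w"
    by blast
  have "\<not> (z < w \<and> w < x)" if "w \<in> X" for w
    using greatest[OF that] z(2) by (auto simp: less_le intro: order.trans)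
  with z assms(2) have "covers X x z" by (auto simp: covers_def)
  then show thesis using z(2) by (rule that)
qed

lemma rank_function_strict_mono:
  assumes "finite X" "rank_function \<rho> X" and "x \<in> X" "y \<in> X" "y < x"
  shows "\<rho> y < \<rho> x"
  using assms(3-5)
proof (induction "card {z \<in> X. z < x}" arbitrary: x rule: less_induct)
  case less
  obtain z where z: "covers X x z" "y \<le> z"
    using exists_lower_cover[OF assms(1) less.prems] .
  then have "z \<in> X" "z < x" by (auto simp: covers_def)
  then have "{w \<in> X. w < z} \<subset> {w \<in> X. w < x}" by auto
  then have "card {w \<in> X. w < z} < card {w \<in> X. w < x}"
    using assms(1) by (simp add: psubset_card_mono)
  with less z \<open>z \<in> X\<close> have "\<rho> y \<le> \<rho> z" by (cases "y = z") (auto simp: less_le)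
  with z assms(2) show ?case by (auto simp: rank_function_def)
qed

lemma rank_function_Diff_maximals:
  assumes "rank_function \<rho> X" and "T \<subseteq> maximals X"
  shows "rank_function \<rho> (X - T)"
proof -
  have "covers X x y" if "covers (X - T) x y" for x y
    using that assms(2) by (auto simp: covers_def maximals_def)
  with assms(1) show ?thesis by (auto simp: rank_function_def)
qed


section \<open>Values in the skeleton\<close>

lemma skeleton_subset: "skeleton X \<subseteq> X"
  by (auto simp: skeleton_def)

lemma finite_skeleton: "finite X \<Longrightarrow> finite (skeleton X)"
  using finite_subset[OF skeleton_subset] .

lemma skeleton_comparable:
  "x \<in> skeleton X \<Longrightarrow> a \<in> X \<Longrightarrow> b \<in> X \<Longrightarrow> x < a \<Longrightarrow> x < b \<Longrightarrow> a \<le> b \<or> b \<le> a"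
  by (auto simp: skeleton_def)

lemma skeleton_upward_closed:
  assumes "x \<in> skeleton X" "y \<in> X" "x \<le> y"
  shows "y \<in> skeleton X"
  using assms unfolding skeleton_def by (auto dest: le_less_trans)

lemma maximals_subset_skeleton: "maximals X \<subseteq> skeleton X"
  by (auto simp: maximals_def skeleton_def)

lemma covers_skeleton_iff:
  "covers (skeleton X) x y \<longleftrightarrow> covers X x y \<and> y \<in> skeleton X"
  using skeleton_upward_closed[of y X] skeleton_subset[of X]
  by (auto simp: covers_def dest: less_imp_le)

lemma nand_value_iff:
  assumes "finite Q" "x \<in> Q"
  shows "nand_value Q x \<longleftrightarrow> (\<exists>y. covers Q x y \<and> \<not> nand_value Q y)"
proof (cases "x \<in> minimals Q")
  case True
  then have "\<not> covers Q x y" for y by (auto simp: minimals_def covers_def)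
  with True show ?thesis by (subst nand_value.simps) simp
next
  case False
  with assms show ?thesis by (subst nand_value.simps) (auto simp: nand_def)
qed

lemma nand_value_local:
  assumes "finite Q" "finite Q'" and "x \<in> Q" and "{y \<in> Q. y \<le> x} = {y \<in> Q'. y \<le> x}"
  shows "nand_value Q x = nand_value Q' x"
  using assms(3,4)
proof (induction "card {y \<in> Q. y < x}" arbitrary: x rule: less_induct)
  case less
  have below: "y \<in> Q \<longleftrightarrow> y \<in> Q'" if "y \<le> x" for y
    using less.prems(2) that by auto
  have covers: "covers Q x y \<longleftrightarrow> covers Q' x y" for y
    using below unfolding covers_def by (auto dest: less_imp_le)
  have "nand_value Q y = nand_value Q' y" if "covers Q x y" for y
  proof -
    from that have y: "y \<in> Q" "y < x" by (auto simp: covers_def)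
    then have "{z \<in> Q. z < y} \<subset> {z \<in> Q. z < x}" by auto
    then have "card {z \<in> Q. z < y} < card {z \<in> Q. z < x}"
      using assms(1) by (simp add: psubset_card_mono)
    moreover have "{z \<in> Q. z \<le> y} = {z \<in> Q'. z \<le> y}"
      using below y by (auto dest: order.trans less_imp_le)
    ultimately show ?thesis using less.hyps y by blast
  qed
  moreover have "x \<in> Q'" using below less.prems(1) by simp
  ultimately show ?case
    using nand_value_iff[OF assms(1) less.prems(1)] nand_value_iff[OF assms(2), of x] covers
    by blast
qed

text \<open>
  Two maximal elements are incomparable, so a skeleton element is below only one of them. Hence
  the component at \<open>m\<close> is everything in the skeleton below \<open>m\<close>, and the values in the whole
  skeleton agree with those in the separate components.
\<close>

lemma nand_eval_skeleton_component:
  assumes "finite P" and m: "m \<in> maximals P"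
  shows "nand_eval (skeleton_component P m) = nand_value (skeleton P) m"
proof -
  have component: "skeleton_component P m = {x \<in> skeleton P. x \<le> m}"
  proof -
    have False if x: "x \<in> skeleton P" "x \<le> m" and m': "m' \<in> maximals P" "m' \<noteq> m" "x \<le> m'" for x m'
      using skeleton_comparable[OF x(1), of m m'] x(2) m m'
      by (auto simp: maximals_def less_le)
    then show ?thesis
      using skeleton_subset by (auto simp: skeleton_component_def maximal_subposet_def)
  qed
  have "m \<in> skeleton P" using m maximals_subset_skeleton by auto
  then have "(THE r. r \<in> maximals (skeleton_component P m)) = m"
    unfolding component by (intro the_equality) (auto simp: maximals_def less_le)
  moreover have "nand_value (skeleton P) m = nand_value (skeleton_component P m) m"
    using assms(1) \<open>m \<in> skeleton P\<close>
    by (intro nand_value_local) (auto simp: component finite_skeleton)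
  ultimately show ?thesis by (simp add: nand_eval_def)
qed

text \<open>
  Let \<open>x < c\<close> be in the new skeleton. A deleted element \<open>a\<close> above \<open>x\<close> must be above \<open>c\<close>: the
  lower cover of \<open>a\<close> on a chain down to \<open>x\<close> is not maximal, so it survives and is comparable
  to \<open>c\<close>; it cannot be strictly below \<open>c\<close>, because the rank of \<open>a\<close> exceeds that of \<open>c\<close>.
  So every element of \<open>X\<close> above \<open>x\<close> is either above \<open>c\<close>, where \<open>X\<close> is a chain, or is below \<open>c\<close>
  and survives. Therefore \<open>X\<close> is a chain above \<open>x\<close> as well.
\<close>

lemma skeleton_below_stable:
  assumes fin: "finite X" and rank: "rank_function \<rho> X" and T: "T \<subseteq> maximals X"
    and c: "c \<in> skeleton X" and less: "\<And>t. t \<in> T \<Longrightarrow> \<rho> c < \<rho> t"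
  shows "{x \<in> skeleton X. x \<le> c} = {x \<in> skeleton (X - T). x \<le> c}"
proof -
  have cX: "c \<in> X" "c \<notin> T" using c less skeleton_subset by auto
  have keep: "x \<notin> T" if "x \<le> c" for x
    using that cX T by (auto simp: maximals_def less_le)
  have "x \<in> skeleton X" if x: "x \<in> skeleton (X - T)" and "x < c" for x
  proof -
    have xX: "x \<in> X - T" using x skeleton_subset by blast
    have above: "c \<le> a \<or> (a \<le> c \<and> a \<in> X - T)" if a: "a \<in> X" "x < a" for a
    proof (cases "a \<in> T")
      case False
      with skeleton_comparable[OF x, of a c] a cX \<open>x < c\<close> show ?thesis by auto
    next
      case True
      obtain y where y: "covers X a y" "x \<le> y"
        using exists_lower_cover[OF fin a(1) _ a(2)] xX by blast
      then have yX: "y \<in> X" "y < a" "y \<notin> T"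
        using T by (auto simp: covers_def maximals_def)
      have "c \<le> y \<or> y < c"
        using skeleton_comparable[OF x, of y c] yX cX \<open>x < c\<close> y(2) by (auto simp: less_le)
      moreover have "\<not> y < c"
        using rank_function_strict_mono[OF fin rank cX(1) yX(1)] less[OF True] y(1) rank
        by (auto simp: rank_function_def)
      ultimately show ?thesis using yX by auto
    qed
    have "a \<le> b \<or> b \<le> a" if "a \<in> X" "b \<in> X" "x < a" "x < b" for a b
      using above[OF that(1,3)] above[OF that(2,4)] that
        skeleton_comparable[OF c that(1,2)] skeleton_comparable[OF x, of a b]
      by (auto simp: less_le)
    with xX show ?thesis by (auto simp: skeleton_def)
  qed
  then have "x \<in> skeleton X" if "x \<in> skeleton (X - T)" "x \<le> c" for x
    using that c by (cases "x = c") (auto simp: less_le)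
  moreover have "x \<in> skeleton (X - T)" if "x \<in> skeleton X" "x \<le> c" for x
    using that keep by (auto simp: skeleton_def)
  ultimately show ?thesis by auto
qed

lemma nand_value_skeleton_stable:
  assumes "finite X" "rank_function \<rho> X" "T \<subseteq> maximals X"
    and "c \<in> skeleton X" and "\<And>t. t \<in> T \<Longrightarrow> \<rho> c < \<rho> t"
  shows "c \<in> skeleton (X - T)"
    and "nand_value (skeleton (X - T)) c = nand_value (skeleton X) c"
proof -
  note stable = skeleton_below_stable[OF assms]
  from stable assms(4) show "c \<in> skeleton (X - T)" by auto
  show "nand_value (skeleton (X - T)) c = nand_value (skeleton X) c"
    using assms(1,4) stable by (intro nand_value_local[symmetric]) (auto simp: finite_skeleton)
qed

lemma maximal_value_iff:
  assumes "finite X" "m \<in> maximals X"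
  shows "nand_value (skeleton X) m \<longleftrightarrow>
    (\<exists>c \<in> skeleton X. covers X m c \<and> \<not> nand_value (skeleton X) c)"
  using nand_value_iff[OF finite_skeleton[OF assms(1)], of m] assms(2) maximals_subset_skeleton
  by (auto simp: covers_skeleton_iff)


section \<open>Balanced positions\<close>

definition balanced :: "'a::order set \<Rightarrow> bool" where
  "balanced X \<longleftrightarrow> (\<forall>m \<in> maximals X. nand_value (skeleton X) m)"

lemma balanced_no_move_to_balanced:
  assumes fin: "finite X" and rank: "rank_function \<rho> X"
    and "balanced X" and "ungar_move X Y"
  shows "\<not> balanced Y"
proof -
  obtain T where T: "T \<noteq> {}" "T \<subseteq> maximals X" "Y = X - T"
    using \<open>ungar_move X Y\<close> by (auto simp: ungar_move_def)
  obtain m where m: "m \<in> T" and least: "\<And>t. t \<in> T \<Longrightarrow> \<rho> m \<le> \<rho> t"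
    using ex_has_least_nat[of "\<lambda>t. t \<in> T" _ \<rho>] T(1) by blast
  have max: "m \<in> maximals X" using m T by auto
  obtain c where c: "c \<in> skeleton X" "covers X m c" "\<not> nand_value (skeleton X) c"
    using \<open>balanced X\<close> max maximal_value_iff[OF fin max] by (auto simp: balanced_def)
  have "\<rho> c < \<rho> t" if "t \<in> T" for t
    using least[OF that] rank c(2) by (auto simp: rank_function_def)
  note stable = nand_value_skeleton_stable[OF fin rank T(2) c(1) this]
  have "\<not> c < z" if "z \<in> Y" for z
  proof
    assume "c < z"
    have z: "z \<in> X" "z \<noteq> m" using \<open>z \<in> Y\<close> T(3) m by auto
    have "z \<le> m \<or> m \<le> z"
      using skeleton_comparable[OF c(1) z(1)] c(2) \<open>c < z\<close> by (auto simp: covers_def)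
    with z \<open>c < z\<close> max c(2) show False
      by (auto simp: maximals_def covers_def less_le)
  qed
  then have "c \<in> maximals Y"
    using stable(1) skeleton_subset T(3) by (auto simp: maximals_def)
  with stable(2) c(3) T(3) show ?thesis by (auto simp: balanced_def)
qed

text \<open>
  The set \<open>S\<close> holds the maximal elements still to be visited, in order of increasing rank.
  Everything maximal outside \<open>S\<close> already has value 1, and its rank is small enough that the
  deletions to come preserve this.
\<close>

lemma balance_by_increasing_rank:
  assumes "finite X" "rank_function \<rho> X" "S \<subseteq> maximals X"
    and "\<And>m. m \<in> maximals X - S \<Longrightarrow> nand_value (skeleton X) m"
    and "\<And>m s. m \<in> maximals X - S \<Longrightarrow> s \<in> S \<Longrightarrow> \<rho> m \<le> \<rho> s"
  shows "\<exists>T \<subseteq> S. balanced (X - T)"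
  using assms
proof (induction "card S" arbitrary: X S)
  case 0
  then have "S = {}"
    using finite_subset[OF maximals_subset \<open>finite X\<close>] finite_subset by fastforce
  with 0 show ?case by (auto simp: balanced_def)
next
  case (Suc n)
  note fin = Suc.prems(1) and rank = Suc.prems(2) and S = Suc.prems(3)
  note ones = Suc.prems(4) and ranks = Suc.prems(5)
  have "S \<noteq> {}" using Suc.hyps(2) by auto
  then obtain s where s: "s \<in> S" and least: "\<And>t. t \<in> S \<Longrightarrow> \<rho> s \<le> \<rho> t"
    using ex_has_least_nat[of "\<lambda>t. t \<in> S" _ \<rho>] by blast
  have max: "s \<in> maximals X" using s S by auto
  have n: "n = card (S - {s})" using Suc.hyps(2) s by simp
  show ?case
  proof (cases "nand_value (skeleton X) s")
    case True
    have "\<exists>T \<subseteq> S - {s}. balanced (X - T)"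
      by (rule Suc.hyps(1)[OF n fin rank]) (use S ones ranks True least in auto)
    then show ?thesis by blast
  next
    case False
    let ?Y = "X - {s}"
    have sub: "{s} \<subseteq> maximals X" using max by simp
    have old_or_new: "m \<in> maximals X \<or> covers X s m \<and> m \<in> skeleton X"
      if m: "m \<in> maximals ?Y" for m
    proof (cases "m < s")
      case True
      have only: "z = s" if "z \<in> X" "m < z" for z
        using m that by (auto simp: maximals_def)
      have "\<not> (m < z \<and> z < s)" if "z \<in> X" for z
        using only[OF that] by auto
      then have "covers X s m" using True m max by (auto simp: covers_def maximals_def)
      moreover have "a \<le> b" if "a \<in> X" "b \<in> X" "m < a" "m < b" for a b
        using only[OF that(1,3)] only[OF that(2,4)] by simp
      then have "m \<in> skeleton X" using m by (auto simp: skeleton_def maximals_def)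
      ultimately show ?thesis by simp
    qed (use m in \<open>auto simp: maximals_def\<close>)
    have one: "nand_value (skeleton ?Y) m \<and> \<rho> m \<le> \<rho> s"
      if m: "m \<in> maximals ?Y" "m \<notin> S - {s}" for m
    proof (cases "m \<in> maximals X")
      case True
      have "m \<noteq> s" using m by (auto simp: maximals_def)
      with True m have mS: "m \<in> maximals X - S" by auto
      have "\<rho> m \<le> \<rho> s" using ranks[OF mS s] .
      obtain c where c: "c \<in> skeleton X" "covers X m c" "\<not> nand_value (skeleton X) c"
        using ones[OF mS] maximal_value_iff[OF fin True] by auto
      have less: "\<rho> c < \<rho> t" if "t \<in> {s}" for t
        using that \<open>\<rho> m \<le> \<rho> s\<close> rank c(2) by (auto simp: rank_function_def)
      have stable: "c \<in> skeleton ?Y" "\<not> nand_value (skeleton ?Y) c"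
        using nand_value_skeleton_stable[OF fin rank sub c(1) less] c(3) by simp_all
      then have "c \<in> ?Y" using skeleton_subset by blast
      with c(2) \<open>m \<noteq> s\<close> have "covers ?Y m c" by (auto simp: covers_def)
      with stable m(1) fin \<open>\<rho> m \<le> \<rho> s\<close> show ?thesis
        using maximal_value_iff[of ?Y m] by blast
    next
      case False
      with old_or_new[OF m(1)] have new: "covers X s m" "m \<in> skeleton X" by auto
      then have less: "\<rho> m < \<rho> t" if "t \<in> {s}" for t
        using that rank by (auto simp: rank_function_def)
      have "nand_value (skeleton X) m"
        using \<open>\<not> nand_value (skeleton X) s\<close> new maximal_value_iff[OF fin max] by auto
      with nand_value_skeleton_stable(2)[OF fin rank sub new(2) less] less[of s] show ?thesis
        by simp
    qed
    have "\<exists>T \<subseteq> S - {s}. balanced (?Y - T)"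
    proof (rule Suc.hyps(1)[OF n])
      show "finite ?Y" using fin by simp
      show "rank_function \<rho> ?Y" using rank max by (intro rank_function_Diff_maximals) auto
      show "S - {s} \<subseteq> maximals ?Y" using S by (auto simp: maximals_def)
    next
      fix m assume "m \<in> maximals ?Y - (S - {s})"
      then show "nand_value (skeleton ?Y) m" using one by blast
    next
      fix m t assume "m \<in> maximals ?Y - (S - {s})" "t \<in> S - {s}"
      then show "\<rho> m \<le> \<rho> t" using one[of m] least[of t] by force
    qed
    then obtain T where "T \<subseteq> S - {s}" "balanced (?Y - T)" by blast
    moreover have "?Y - T = X - insert s T" by auto
    ultimately show ?thesis using s by (intro exI[of _ "insert s T"]) auto
  qed
qed

lemma unbalanced_move_to_balanced:
  assumes "finite X" "rank_function \<rho> X" "\<not> balanced X"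
  shows "\<exists>Y. ungar_move X Y \<and> balanced Y"
proof -
  obtain T where "T \<subseteq> maximals X" "balanced (X - T)"
    using balance_by_increasing_rank[OF assms(1,2), of "maximals X"] by auto
  moreover from this assms(3) have "T \<noteq> {}" by auto
  ultimately show ?thesis by (auto simp: ungar_move_def)
qed

theorem theorem1p8:
  fixes P :: "'a::order set"
  assumes "finite P" and "graded P"
  shows "eeta_win P \<longleftrightarrow> (\<forall>m \<in> maximals P. nand_eval (skeleton_component P m))"
proof -
  obtain \<rho> :: "'a \<Rightarrow> nat" where \<rho>: "rank_function \<rho> P"
    using assms(2) by (auto simp: graded_def rank_function_def)
  have "eeta_win P \<longleftrightarrow> balanced P"
  proof (rule eeta_win_iff_kernel[where G = "\<lambda>X. finite X \<and> rank_function \<rho> X"])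
    fix X Y assume "finite X \<and> rank_function \<rho> X" "ungar_move X Y"
    then show "finite Y \<and> rank_function \<rho> Y"
      by (auto simp: ungar_move_def intro: rank_function_Diff_maximals)
  qed (use assms(1) \<rho> balanced_no_move_to_balanced unbalanced_move_to_balanced in blast)+
  then show ?thesis
    using nand_eval_skeleton_component[OF assms(1)] by (simp add: balanced_def)
qed

end
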